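(* Let $H$ be a hypergraph. Then $$T_{\mathrm{HG}}(H;x,y)=(x-1)^{-\kappa(H)}(y-1)^{-v(H)}\,Z_{\mathrm{RC}}\big(H;(x-1)(y-1),\,y-1\big)$$ (as an identity of rational functions in $x,y$), and $$Z_{\mathrm{RC}}(H;q,v)=q^{\kappa(H)}\,v^{\,v(H)-\kappa(H)}\,T_{\mathrm{HG}}\!\left(H;1+\frac{q}{v},\,1+v\right)$$ for $v\neq0$. (Here $v$ as a variable is distinct from the vertex count $v(H)$.)
   Context: A hypergraph is a pair $H=(V,E)$ where $V$ is a finite set and $E$ is a finite multiset (parallel hyperedges are allowed and treated as distinct elements of $E$) of multisets of elements of $V$, called hyperedges. For $e\in E$, $d(e)$ is the size of $e$ counted with multiplicity; it is always assumed that $d(e)>1$. Write $v(H)=|V|$. $\kappa(H)$ is the number of connected components of the bipartite incidence graph with vertex classes $V$ and $E$, in which $u\in V$ and $e\in E$ are joined by as many edges as the multiplicity of $u$ in $e$. For $A\subseteq E$ let $\kappa(A)=\kappa((V,A))$, $d(A)=\sum_{e\in A}d(e)$, and $|A|$ is the number of hyperedges in $A$. Hypergraph Tutte polynomial: $T_{\mathrm{HG}}(H;x,y)=\sum_{A\subseteq E}(x-1)^{\kappa(A)-\kappa(H)}(y-1)^{d(A)-|A|-v(H)+\kappa(A)}$. Degree-dependent hypergraph random cluster partition function: $Z_{\mathrm{RC}}(H;q,v)=\sum_{A\subseteq E}q^{\kappa(A)}\prod_{e\in A}v^{d(e)-1}$. *)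

theory Defs
  imports
    "HOL-Library.Multiset"
    "HOL-Computational_Algebra.Polynomial_Factorial"
    "Graph_Theory.Digraph_Component"
begin

text \<open>
  The multiset of hyperedges is given as a finite set of labels together with a map sending each
  label to the multiset of its vertices. Parallel hyperedges are distinct labels with the same
  image, so that a sub-multiset of hyperedges is a set of labels.
\<close>

record ('v, 'e) hypergraph =
  vertices :: "'v set"
  hyperedges :: "'e set"
  ends :: "'e \<Rightarrow> 'v multiset"

definition hyperdegree :: "('v, 'e) hypergraph \<Rightarrow> 'e \<Rightarrow> nat" where
  "hyperdegree H e = size (ends H e)"

definition is_hypergraph :: "('v, 'e) hypergraph \<Rightarrow> bool" where
  "is_hypergraph H \<longleftrightarrow>
     finite (vertices H) \<and> finite (hyperedges H) \<and>
     (\<forall>e \<in> hyperedges H. set_mset (ends H e) \<subseteq> vertices H \<and> hyperdegree H e > 1)"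

text \<open>
  The arcs \<open>(u, e, i)\<close> with \<open>i < count (ends H e) u\<close> are the parallel edges between \<open>u\<close> and \<open>e\<close>.
  Their orientation from \<open>u\<close> to \<open>e\<close> is immaterial: \<^const>\<open>connected\<close> refers to the underlying
  undirected graph and holds only for graphs with at least one vertex.
\<close>

definition incidence_graph ::
    "('v, 'e) hypergraph \<Rightarrow> ('v + 'e, 'v \<times> 'e \<times> nat) pre_digraph" where
  "incidence_graph H =
     \<lparr>verts = Inl ` vertices H \<union> Inr ` hyperedges H,
      arcs = {(u, e, i). e \<in> hyperedges H \<and> i < count (ends H e) u},
      tail = (\<lambda>(u, e, i). Inl u),
      head = (\<lambda>(u, e, i). Inr e)\<rparr>"

definition num_components :: "('a, 'b) pre_digraph \<Rightarrow> nat" where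
  "num_components G = card {C. pre_digraph.max_subgraph G connected C}"

definition kappa :: "('v, 'e) hypergraph \<Rightarrow> nat" where
  "kappa H = num_components (incidence_graph H)"

definition kappa_of :: "('v, 'e) hypergraph \<Rightarrow> 'e set \<Rightarrow> nat" where
  "kappa_of H A = kappa (H\<lparr>hyperedges := A\<rparr>)"

definition total_degree :: "('v, 'e) hypergraph \<Rightarrow> 'e set \<Rightarrow> nat" where
  "total_degree H A = (\<Sum>e\<in>A. hyperdegree H e)"

definition T_HG :: "('v, 'e) hypergraph \<Rightarrow> 'k::field \<Rightarrow> 'k \<Rightarrow> 'k" where
  "T_HG H x y =
     (\<Sum>A\<in>Pow (hyperedges H).
        (x - 1) powi (int (kappa_of H A) - int (kappa H)) *
        (y - 1) powi (int (total_degree H A) - int (card A) - int (card (vertices H))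
                      + int (kappa_of H A)))"

definition Z_RC :: "('v, 'e) hypergraph \<Rightarrow> 'k::field \<Rightarrow> 'k \<Rightarrow> 'k" where
  "Z_RC H q v =
     (\<Sum>A\<in>Pow (hyperedges H). q ^ kappa_of H A * (\<Prod>e\<in>A. v ^ (hyperdegree H e - 1)))"

text \<open>The two indeterminates of the field of rational functions in two variables over \<open>'k\<close>.\<close>

definition rat_X :: "'k::field poly poly fract" where
  "rat_X = to_fract [:[:0, 1:]:]"

definition rat_Y :: "'k::field poly poly fract" where
  "rat_Y = to_fract [:0, 1:]"

end

theory Submission
  imports Defs
begin

text \<open>
  Both sides of the second identity agree summand by summand, by adding exponents; the first
  identity is the second at \<open>q = (x - 1) (y - 1)\<close> and \<open>v = y - 1\<close>. The only delicate point is
  \<open>q = 0\<close>, where \<open>q\<^sup>\<kappa>\<^sup>(\<^sup>H\<^sup>)\<close> cannot be cancelled. There it suffices that \<open>\<kappa>(A)\<close> and \<open>\<kappa>(H)\<close> vanish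
  simultaneously, namely exactly when there are no vertices.
\<close>

lemma subgraph_antisym:
  assumes "subgraph G H" and "subgraph H G"
  shows "G = H"
  using assms by (auto simp: subgraph_def compatible_def intro: pre_digraph.equality)

lemma (in fin_digraph) finite_subgraphs: "finite {H. subgraph H G}"
proof (rule inj_on_finite)
  show "inj_on (\<lambda>H. (verts H, arcs H)) {H. subgraph H G}"
    by (auto simp: inj_on_def subgraph_def compatible_def intro: pre_digraph.equality)
  show "(\<lambda>H. (verts H, arcs H)) ` {H. subgraph H G} \<subseteq> Pow (verts G) \<times> Pow (arcs G)"
    by (auto simp: subgraph_def)
qed simp

lemma (in fin_digraph) ex_max_subgraph:
  assumes "subgraph H G" and "P H"
  shows "\<exists>M. max_subgraph P M"
proof -
  let ?\<S> = "{K. subgraph K G \<and> P K}"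
  let ?proper = "\<lambda>K L :: ('a, 'b) pre_digraph. subgraph K L \<and> K \<noteq> L"
  have "finite ?\<S>"
    by (rule finite_subset[OF _ finite_subgraphs]) blast
  moreover have "asymp_on ?\<S> ?proper"
    by (rule asymp_onI) (blast dest: subgraph_antisym)
  moreover have "transp_on ?\<S> ?proper"
    by (rule transp_onI) (blast dest: subgraph_antisym intro: subgraph_trans)
  moreover have "?\<S> \<noteq> {}"
    using assms by blast
  ultimately have "\<exists>M\<in>?\<S>. \<forall>K\<in>?\<S>. K \<noteq> M \<longrightarrow> \<not> ?proper M K"
    by (rule Finite_Set.bex_max_element)
  then show ?thesis
    unfolding max_subgraph_def by blast
qed

lemma connected_if_single_vertex:
  assumes "verts G = {u}"
  shows "connected G"
  using assms
  by (simp add: connected_def mk_symmetric_def strongly_connected_def reachable_def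
      rtrancl_on.rtrancl_on_refl)

lemma (in fin_digraph) num_components_eq_0_iff: "num_components G = 0 \<longleftrightarrow> verts G = {}"
proof -
  have "finite {C. max_subgraph connected C}"
    by (rule finite_subset[OF _ finite_subgraphs]) (auto dest: subgraphI_max_subgraph)
  then have "num_components G = 0 \<longleftrightarrow> (\<nexists>C. max_subgraph connected C)"
    by (simp add: num_components_def)
  also have "\<dots> \<longleftrightarrow> verts G = {}"
  proof
    assume no_component: "\<nexists>C. max_subgraph connected C"
    show "verts G = {}"
    proof (rule equals0I)
      fix u assume "u \<in> verts G"
      then have "subgraph (G \<restriction> {u}) G"
        by (simp add: subgraph_induce_subgraphI)
      moreover have "connected (G \<restriction> {u})"
        by (rule connected_if_single_vertex) simp
      ultimately have "\<exists>C. max_subgraph connected C"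
        by (rule ex_max_subgraph)
      with no_component show False by contradiction
    qed
  next
    assume "verts G = {}"
    then show "\<nexists>C. max_subgraph connected C"
      by (auto simp: max_subgraph_def subgraph_def connected_def strongly_connected_def
          mk_symmetric_def)
  qed
  finally show ?thesis .
qed

lemma fin_digraph_incidence_graph:
  assumes "is_hypergraph H"
  shows "fin_digraph (incidence_graph H)"
proof
  have arcs_subset: "arcs (incidence_graph H) \<subseteq>
      (SIGMA u:vertices H. SIGMA e:hyperedges H. {..<count (ends H e) u})"
  proof
    fix a assume "a \<in> arcs (incidence_graph H)"
    then obtain u e i where "a = (u, e, i)" "e \<in> hyperedges H" "i < count (ends H e) u"
      by (auto simp: incidence_graph_def)
    moreover from this have "u \<in># ends H e"
      by (simp flip: count_greater_zero_iff)
    ultimately show "a \<in> (SIGMA u:vertices H. SIGMA e:hyperedges H. {..<count (ends H e) u})"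
      using assms by (auto simp: is_hypergraph_def)
  qed
  then show "finite (arcs (incidence_graph H))"
    by (rule finite_subset) (use assms in \<open>auto simp: is_hypergraph_def\<close>)
  show "finite (verts (incidence_graph H))"
    using assms by (simp add: is_hypergraph_def incidence_graph_def)
  show "tail (incidence_graph H) a \<in> verts (incidence_graph H)"
      "head (incidence_graph H) a \<in> verts (incidence_graph H)"
    if "a \<in> arcs (incidence_graph H)" for a
    using that arcs_subset by (auto simp: incidence_graph_def)
qed

lemma hyperedges_empty_if_vertices_empty:
  assumes "is_hypergraph H" and "vertices H = {}"
  shows "hyperedges H = {}"
  using assms by (auto simp: is_hypergraph_def hyperdegree_def)

lemma kappa_eq_0_iff:
  assumes "is_hypergraph H"
  shows "kappa H = 0 \<longleftrightarrow> vertices H = {}"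
proof -
  have "kappa H = 0 \<longleftrightarrow> verts (incidence_graph H) = {}"
    unfolding kappa_def
    by (rule fin_digraph.num_components_eq_0_iff[OF fin_digraph_incidence_graph[OF assms]])
  also have "\<dots> \<longleftrightarrow> vertices H = {}"
    using hyperedges_empty_if_vertices_empty[OF assms] by (auto simp: incidence_graph_def)
  finally show ?thesis .
qed

lemma is_hypergraph_restrict:
  assumes "is_hypergraph H" and "A \<subseteq> hyperedges H"
  shows "is_hypergraph (H\<lparr>hyperedges := A\<rparr>)"
  using assms by (auto simp: is_hypergraph_def hyperdegree_def intro: finite_subset)

lemma kappa_of_eq_0_iff:
  assumes "is_hypergraph H" and "A \<subseteq> hyperedges H"
  shows "kappa_of H A = 0 \<longleftrightarrow> kappa H = 0"
  using assms by (simp add: kappa_of_def kappa_eq_0_iff is_hypergraph_restrict)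

lemma power_eq_power_mult_power_int_diff:
  fixes q :: "'k::field"
  assumes "m = 0 \<Longrightarrow> n = 0"
  shows "q ^ m = q ^ n * q powi (int m - int n)"
proof (cases "q = 0")
  case True
  with assms show ?thesis
    by (cases "m = n") (auto simp: power_0_left)
next
  case False
  then show ?thesis by (simp add: power_int_diff)
qed

lemma prod_power_hyperdegree:
  fixes v :: "'k::field"
  assumes "is_hypergraph H" and "A \<subseteq> hyperedges H"
  shows "(\<Prod>e\<in>A. v ^ (hyperdegree H e - 1)) = v powi (int (total_degree H A) - int (card A))"
proof -
  have "int (hyperdegree H e - 1) = int (hyperdegree H e) - 1" if "e \<in> A" for e
    using assms that by (force simp: is_hypergraph_def)
  then have "int (\<Sum>e\<in>A. hyperdegree H e - 1) = int (total_degree H A) - int (card A)"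
    by (simp add: total_degree_def sum_subtractf)
  then show ?thesis
    by (metis power_int_of_nat power_sum)
qed

lemma Z_RC_eq_T_HG:
  fixes q v :: "'k::field"
  assumes "is_hypergraph H" and "v \<noteq> 0"
  shows "Z_RC H q v =
    q ^ kappa H * v powi (int (card (vertices H)) - int (kappa H)) * T_HG H (1 + q / v) (1 + v)"
  unfolding T_HG_def Z_RC_def sum_distrib_left
proof (rule sum.cong[OF refl])
  fix A assume "A \<in> Pow (hyperedges H)"
  then have A: "A \<subseteq> hyperedges H" by simp
  define k where "k = int (kappa_of H A) - int (kappa H)"
  define r where "r = int (total_degree H A) - int (card A)"
  define n where "n = int (card (vertices H))"
  have "q ^ kappa_of H A = q ^ kappa H * q powi k"
    unfolding k_def
    using kappa_of_eq_0_iff[OF assms(1) A] by (intro power_eq_power_mult_power_int_diff) simp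
  also have "q powi k = (q / v) powi k * v powi k"
    using assms(2) by (simp flip: power_int_mult_distrib)
  finally have "q ^ kappa_of H A * v powi r =
      q ^ kappa H * (q / v) powi k * (v powi k * v powi r)"
    by (simp only: mult.assoc)
  also have "v powi k * v powi r =
      v powi (n - int (kappa H)) * v powi (r - n + int (kappa_of H A))"
    using assms(2) by (simp add: k_def algebra_simps flip: power_int_add)
  finally show "q ^ kappa_of H A * (\<Prod>e\<in>A. v ^ (hyperdegree H e - 1)) =
      q ^ kappa H * v powi (int (card (vertices H)) - int (kappa H)) *
      ((1 + q / v - 1) powi (int (kappa_of H A) - int (kappa H)) *
       (1 + v - 1) powi (int (total_degree H A) - int (card A) - int (card (vertices H))
         + int (kappa_of H A)))"
    by (simp add: prod_power_hyperdegree[OF assms(1) A] k_def r_def n_def mult_ac del: One_nat_def)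
qed

lemma T_HG_eq_Z_RC:
  fixes x y :: "'k::field"
  assumes "is_hypergraph H" and "x \<noteq> 1" and "y \<noteq> 1"
  shows "T_HG H x y =
    (x - 1) powi (- int (kappa H)) * (y - 1) powi (- int (card (vertices H))) *
    Z_RC H ((x - 1) * (y - 1)) (y - 1)"
proof -
  define a where "a = x - 1"
  define b where "b = y - 1"
  have nonzero: "a \<noteq> 0" "b \<noteq> 0"
    using assms(2,3) by (simp_all add: a_def b_def)
  have "1 + a * b / b = x" "1 + b = y"
    using nonzero by (simp_all add: a_def b_def)
  with Z_RC_eq_T_HG[OF assms(1) nonzero(2), of "a * b"]
  have "Z_RC H (a * b) b =
      (a * b) ^ kappa H * b powi (int (card (vertices H)) - int (kappa H)) * T_HG H x y"
    by simp
  with nonzero have "T_HG H x y =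
      a powi (- int (kappa H)) * b powi (- int (card (vertices H))) * Z_RC H (a * b) b"
    by (simp add: power_int_diff power_int_minus power_mult_distrib field_simps)
  then show ?thesis
    unfolding a_def b_def .
qed

lemma rat_X_neq_1: "rat_X \<noteq> 1"
  by (simp add: rat_X_def one_pCons flip: to_fract_1)

lemma rat_Y_neq_1: "rat_Y \<noteq> 1"
  by (simp add: rat_Y_def one_pCons flip: to_fract_1)

theorem proposition5p6:
  fixes H :: "('v, 'e) hypergraph"
  assumes "is_hypergraph H"
  shows "T_HG H (rat_X :: 'k::field poly poly fract) rat_Y =
           (rat_X - 1) powi (- int (kappa H)) * (rat_Y - 1) powi (- int (card (vertices H))) *
           Z_RC H ((rat_X - 1) * (rat_Y - 1)) (rat_Y - 1) \<and>
         (\<forall>q v :: 'k. v \<noteq> 0 \<longrightarrow>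
            Z_RC H q v =
              q ^ kappa H * v powi (int (card (vertices H)) - int (kappa H)) *
              T_HG H (1 + q / v) (1 + v))"
  using T_HG_eq_Z_RC[OF assms rat_X_neq_1 rat_Y_neq_1] Z_RC_eq_T_HG[OF assms] by blast

end
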